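(* Let $G$ be a (multiplicatively written) group that admits an exact factorization through subgroups $A$ and $B$, and let $(G,r_G)$ be its associated solution to the Yang--Baxter equation. For elements $c\in A$ and $d\in B$ which are central in $G$ and such that $cd$ is central in $G$, the map $k\colon G\to G$, $k(x)=x(cd)$, is a reflection of $(G,r_G)$.
   Context: A group $G$ admits an exact factorization through subgroups $A$ and $B$ if $G=AB=\{ab:a\in A,b\in B\}$ and $A\cap B=\{1\}$; thus each $x\in G$ is uniquely $x=ab$ with $a\in A$, $b\in B$. Define a second operation on $G$ by $x\circ y=ayb$ whenever $x=ab$ with $a\in A$, $b\in B$; then $(G,\circ)$ is a group (and $G$ with its original product as "additive" group and $\circ$ is a skew left brace). Write $x'$ for the inverse of $x$ in $(G,\circ)$, $\lambda_x(y)=x^{-1}(x\circ y)=b^{-1}yb$ for $x=ab$ (with $x^{-1}$ the inverse for the original product), and $\mu_y(x)=\lambda_x(y)'\circ x\circ y$. The associated solution is $r_G\colon G\times G\to G\times G$, $r_G(x,y)=(\lambda_x(y),\mu_y(x))$, a non-degenerate set-theoretic solution to the Yang--Baxter equation $(r\times\mathrm{id})(\mathrm{id}\times r)(r\times\mathrm{id})=(\mathrm{id}\times r)(r\times\mathrm{id})(\mathrm{id}\times r)$. A map $k\colon X\to X$ is a reflection of a non-degenerate solution $(X,r)$ if $r(\mathrm{id}\times k)r(\mathrm{id}\times k)=(\mathrm{id}\times k)r(\mathrm{id}\times k)r$. *)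

theory Defs
  imports "HOL-Algebra.Coset"
begin

section \<open>Set-theoretic solutions and reflections\<close>

text \<open>Triples are nested to the right, so id \<times> r is \<^term>\<open>map_prod id r\<close>,
  while r \<times> id needs reassociation.\<close>

definition prod_id :: "('a \<times> 'a \<Rightarrow> 'a \<times> 'a) \<Rightarrow> 'a \<times> 'a \<times> 'a \<Rightarrow> 'a \<times> 'a \<times> 'a" where
  "prod_id r = (\<lambda>(x, y, z). case r (x, y) of (u, v) \<Rightarrow> (u, v, z))"

definition ybe_solution :: "'a set \<Rightarrow> ('a \<times> 'a \<Rightarrow> 'a \<times> 'a) \<Rightarrow> bool" where
  "ybe_solution X r \<longleftrightarrow>
     r \<in> X \<times> X \<rightarrow> X \<times> X \<and>
     (\<forall>t \<in> X \<times> X \<times> X.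
        (prod_id r \<circ> map_prod id r \<circ> prod_id r) t =
        (map_prod id r \<circ> prod_id r \<circ> map_prod id r) t)"

definition nondegenerate :: "'a set \<Rightarrow> ('a \<times> 'a \<Rightarrow> 'a \<times> 'a) \<Rightarrow> bool" where
  "nondegenerate X r \<longleftrightarrow>
     (\<forall>x \<in> X. bij_betw (\<lambda>y. fst (r (x, y))) X X) \<and>
     (\<forall>y \<in> X. bij_betw (\<lambda>x. snd (r (x, y))) X X)"

text \<open>Reflections are only defined for non-degenerate solutions, so this requirement on
  \<^term>\<open>(X, r)\<close> is part of the predicate.\<close>

definition ybe_reflection :: "'a set \<Rightarrow> ('a \<times> 'a \<Rightarrow> 'a \<times> 'a) \<Rightarrow> ('a \<Rightarrow> 'a) \<Rightarrow> bool" where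
  "ybe_reflection X r k \<longleftrightarrow>
     ybe_solution X r \<and> nondegenerate X r \<and>
     k \<in> X \<rightarrow> X \<and>
     (\<forall>p \<in> X \<times> X.
        (r \<circ> map_prod id k \<circ> r \<circ> map_prod id k) p =
        (map_prod id k \<circ> r \<circ> map_prod id k \<circ> r) p)"

section \<open>Exact factorizations and the associated solution\<close>

definition exact_factorization :: "('a, 'm) monoid_scheme \<Rightarrow> 'a set \<Rightarrow> 'a set \<Rightarrow> bool" where
  "exact_factorization G A B \<longleftrightarrow>
     subgroup A G \<and> subgroup B G \<and> carrier G = A <#>\<^bsub>G\<^esub> B \<and> A \<inter> B = {\<one>\<^bsub>G\<^esub>}"

text \<open>The unique pair (a, b) in A \<times> B with x = ab; meaningful only for
  an exact factorization and \<^term>\<open>x \<in> carrier G\<close>.\<close>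

definition factors :: "('a, 'm) monoid_scheme \<Rightarrow> 'a set \<Rightarrow> 'a set \<Rightarrow> 'a \<Rightarrow> 'a \<times> 'a" where
  "factors G A B x = (THE p. p \<in> A \<times> B \<and> x = fst p \<otimes>\<^bsub>G\<^esub> snd p)"

definition circ :: "('a, 'm) monoid_scheme \<Rightarrow> 'a set \<Rightarrow> 'a set \<Rightarrow> 'a \<Rightarrow> 'a \<Rightarrow> 'a" where
  "circ G A B x y = (case factors G A B x of (a, b) \<Rightarrow> a \<otimes>\<^bsub>G\<^esub> y \<otimes>\<^bsub>G\<^esub> b)"

definition circ_group :: "('a, 'm) monoid_scheme \<Rightarrow> 'a set \<Rightarrow> 'a set \<Rightarrow> 'a monoid" where
  "circ_group G A B = \<lparr>carrier = carrier G, mult = circ G A B, one = \<one>\<^bsub>G\<^esub>\<rparr>"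

text \<open>\<^term>\<open>brace_lambda G A B x y\<close> is lambda-x(y), and \<^term>\<open>brace_mu G A B y x\<close> is
  mu-y(x): the subscript comes first in both.\<close>

definition brace_lambda :: "('a, 'm) monoid_scheme \<Rightarrow> 'a set \<Rightarrow> 'a set \<Rightarrow> 'a \<Rightarrow> 'a \<Rightarrow> 'a" where
  "brace_lambda G A B x y = inv\<^bsub>G\<^esub> x \<otimes>\<^bsub>G\<^esub> (x \<otimes>\<^bsub>circ_group G A B\<^esub> y)"

definition brace_mu :: "('a, 'm) monoid_scheme \<Rightarrow> 'a set \<Rightarrow> 'a set \<Rightarrow> 'a \<Rightarrow> 'a \<Rightarrow> 'a" where
  "brace_mu G A B y x =
     inv\<^bsub>circ_group G A B\<^esub> (brace_lambda G A B x y)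
       \<otimes>\<^bsub>circ_group G A B\<^esub> x \<otimes>\<^bsub>circ_group G A B\<^esub> y"

definition associated_solution ::
    "('a, 'm) monoid_scheme \<Rightarrow> 'a set \<Rightarrow> 'a set \<Rightarrow> 'a \<times> 'a \<Rightarrow> 'a \<times> 'a" where
  "associated_solution G A B = (\<lambda>(x, y). (brace_lambda G A B x y, brace_mu G A B y x))"

definition central :: "('a, 'm) monoid_scheme \<Rightarrow> 'a \<Rightarrow> bool" where
  "central G z \<longleftrightarrow> z \<in> carrier G \<and> (\<forall>x \<in> carrier G. z \<otimes>\<^bsub>G\<^esub> x = x \<otimes>\<^bsub>G\<^esub> z)"

end

theory Submission
  imports Defs
begin

text \<open>Write x = ab. Then \<open>\<lambda>\<^sub>x(y) = b\<^sup>-\<^sup>1yb\<close>, and with \<open>u = \<lambda>\<^sub>x(y) = a\<^sub>ub\<^sub>u\<close> one finds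
  \<open>x \<circ> y = xu\<close>, hence \<open>\<mu>\<^sub>y(x) = a\<^sub>u\<^sup>-\<^sup>1xa\<^sub>u\<close>. For z = cd this gives
  \<open>r(x, yz) = (uz, v)\<close> and \<open>r(xz, y) = (u, vz)\<close> whenever \<open>r(x, y) = (u, v)\<close>: multiplying by z
  multiplies the A- and B-parts by the central elements c and d, which does not affect
  conjugation. Both sides of the reflection equation at \<open>(x, y)\<close> are therefore \<open>(sz, tz)\<close>, where
  \<open>(s, t) = r(r(x, y))\<close>. The Yang--Baxter equation and non-degeneracy hold because \<open>\<lambda>\<close> is a left
  action and \<open>\<mu>\<close> a right action of the group \<open>(G, \<circ>)\<close>, and r preserves \<open>\<circ>\<close>-products.\<close>

section \<open>Exact factorizations and the two parts of an element\<close>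

locale exactly_factorized_group = group G for G (structure) +
  fixes A B
  assumes exact: "exact_factorization G A B"
begin

definition fA where "fA x = fst (factors G A B x)"
definition fB where "fB x = snd (factors G A B x)"

abbreviation Q where "Q \<equiv> circ_group G A B"
abbreviation qmult (infixl "\<odot>" 70) where "x \<odot> y \<equiv> x \<otimes>\<^bsub>Q\<^esub> y"
abbreviation lam where "lam \<equiv> brace_lambda G A B"
abbreviation mu where "mu \<equiv> brace_mu G A B"

text \<open>These rules cancel inside the right-nested products that \<open>m_assoc\<close>
  produces.\<close>

lemma inv_mult_cancel_left [simp]:
  "x \<in> carrier G \<Longrightarrow> y \<in> carrier G \<Longrightarrow> inv x \<otimes> (x \<otimes> y) = y"
  "x \<in> carrier G \<Longrightarrow> y \<in> carrier G \<Longrightarrow> x \<otimes> (inv x \<otimes> y) = y"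
  by (simp_all add: m_assoc[symmetric])

lemma subgroup_A: "subgroup A G" and subgroup_B: "subgroup B G"
  using exact by (auto simp: exact_factorization_def)

lemmas A_simps = subgroup.m_closed[OF subgroup_A] subgroup.m_inv_closed[OF subgroup_A]
  subgroup.one_closed[OF subgroup_A]
lemmas B_simps = subgroup.m_closed[OF subgroup_B] subgroup.m_inv_closed[OF subgroup_B]
  subgroup.one_closed[OF subgroup_B]

lemma A_closed: "a \<in> A \<Longrightarrow> a \<in> carrier G" and B_closed: "b \<in> B \<Longrightarrow> b \<in> carrier G"
  using subgroup.subset[OF subgroup_A] subgroup.subset[OF subgroup_B] by auto

text \<open>The element \<open>inv a' \<otimes> a = b' \<otimes> inv b\<close> lies in both
  \<open>A\<close> and \<open>B\<close>, so it is trivial.\<close>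

lemma factorization_unique:
  assumes "a \<in> A" "b \<in> B" "a' \<in> A" "b' \<in> B" "a \<otimes> b = a' \<otimes> b'"
  shows "a = a' \<and> b = b'"
proof -
  have C: "a \<in> carrier G" "b \<in> carrier G" "a' \<in> carrier G" "b' \<in> carrier G"
    using assms A_closed B_closed by auto
  have "inv a' \<otimes> a = inv a' \<otimes> (a \<otimes> b) \<otimes> inv b"
    using C by (simp add: m_assoc)
  also have "\<dots> = b' \<otimes> inv b"
    using C by (simp add: assms(5) m_assoc)
  finally have e: "inv a' \<otimes> a = b' \<otimes> inv b" .
  then have "inv a' \<otimes> a \<in> A \<inter> B"
    using assms(1-4) by (metis A_simps(1,2) B_simps(1,2) IntI)
  then have "inv a' \<otimes> a = \<one>"
    using exact by (auto simp: exact_factorization_def)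
  then have "a = a'"
    using C by (metis inv_equality inv_inv inv_closed)
  then show ?thesis
    using C assms(5) by simp
qed

lemma factors_mult:
  assumes "a \<in> A" "b \<in> B"
  shows "factors G A B (a \<otimes> b) = (a, b)"
  unfolding factors_def
  by (rule the_equality) (use assms in \<open>auto dest: factorization_unique\<close>)

lemma fA_mult: "a \<in> A \<Longrightarrow> b \<in> B \<Longrightarrow> fA (a \<otimes> b) = a"
  and fB_mult: "a \<in> A \<Longrightarrow> b \<in> B \<Longrightarrow> fB (a \<otimes> b) = b"
  by (simp_all add: fA_def fB_def factors_mult)

lemma factorE:
  assumes "x \<in> carrier G"
  obtains a b where "a \<in> A" "b \<in> B" "x = a \<otimes> b"
  using assms exact by (auto simp: exact_factorization_def set_mult_def)

lemma fA_in: "x \<in> carrier G \<Longrightarrow> fA x \<in> A"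
  and fB_in: "x \<in> carrier G \<Longrightarrow> fB x \<in> B"
  and fA_fB: "x \<in> carrier G \<Longrightarrow> fA x \<otimes> fB x = x"
  by (auto elim!: factorE simp: fA_mult fB_mult)

lemma fA_closed [simp]: "x \<in> carrier G \<Longrightarrow> fA x \<in> carrier G"
  and fB_closed [simp]: "x \<in> carrier G \<Longrightarrow> fB x \<in> carrier G"
  using fA_in fB_in A_closed B_closed by auto

lemma fA_one: "fA \<one> = \<one>" and fB_one: "fB \<one> = \<one>"
  using fA_mult[of \<one> \<one>] fB_mult[of \<one> \<one>] by (simp_all add: A_simps B_simps)

section \<open>The second group structure\<close>

lemma carrier_Q [simp]: "carrier Q = carrier G" and one_Q [simp]: "\<one>\<^bsub>Q\<^esub> = \<one>"
  by (simp_all add: circ_group_def)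

lemma qmult_eq: "x \<odot> y = fA x \<otimes> y \<otimes> fB x"
  by (simp add: circ_group_def circ_def fA_def fB_def split: prod.split)

lemma qmult_factored:
  assumes "x \<in> carrier G" "y \<in> carrier G"
  shows "x \<odot> y = (fA x \<otimes> fA y) \<otimes> (fB y \<otimes> fB x)"
proof -
  have "x \<odot> y = fA x \<otimes> (fA y \<otimes> fB y) \<otimes> fB x"
    using assms by (simp add: qmult_eq fA_fB)
  then show ?thesis
    using assms by (simp add: m_assoc)
qed

text \<open>The \<open>A\<close>-parts multiply in order and the \<open>B\<close>-parts in reverse
  order, so \<open>Q\<close> is a copy of the direct product of \<open>A\<close> with the opposite
  group of \<open>B\<close>.\<close>

lemma fA_qmult: "x \<in> carrier G \<Longrightarrow> y \<in> carrier G \<Longrightarrow> fA (x \<odot> y) = fA x \<otimes> fA y"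
  and fB_qmult: "x \<in> carrier G \<Longrightarrow> y \<in> carrier G \<Longrightarrow> fB (x \<odot> y) = fB y \<otimes> fB x"
  by (simp_all add: qmult_factored fA_mult fB_mult fA_in fB_in A_simps B_simps)

lemma group_Q: "group Q"
proof (rule groupI)
  fix x y z assume "x \<in> carrier Q" "y \<in> carrier Q" "z \<in> carrier Q"
  then have C: "x \<in> carrier G" "y \<in> carrier G" "z \<in> carrier G" by simp_all
  have "(x \<odot> y) \<odot> z = fA x \<otimes> fA y \<otimes> z \<otimes> (fB y \<otimes> fB x)"
    using C by (simp add: qmult_eq[of "x \<odot> y"] fA_qmult fB_qmult)
  also have "\<dots> = x \<odot> (y \<odot> z)"
    using C by (simp add: qmult_eq m_assoc)
  finally show "(x \<odot> y) \<odot> z = x \<odot> (y \<odot> z)" .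
next
  fix x assume "x \<in> carrier Q"
  then have C: "x \<in> carrier G" by simp
  \<comment> \<open>The two parts are inverted separately; in general this is not the inverse of
    \<open>x\<close> in \<open>G\<close>.\<close>
  let ?y = "inv (fA x) \<otimes> inv (fB x)"
  have "fA ?y = inv (fA x)" "fB ?y = inv (fB x)"
    using C by (simp_all add: fA_mult fB_mult fA_in fB_in A_simps B_simps)
  then have "?y \<odot> x = inv (fA x) \<otimes> (fA x \<otimes> fB x) \<otimes> inv (fB x)"
    using C by (simp add: qmult_eq fA_fB)
  also have "\<dots> = \<one>"
    using C by (simp add: m_assoc)
  finally show "\<exists>y\<in>carrier Q. y \<odot> x = \<one>\<^bsub>Q\<^esub>"
    using C by (intro bexI[of _ ?y]) auto
qed (simp_all add: qmult_eq fA_one fB_one)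

sublocale Q: group Q
  by (rule group_Q)

lemma qmult_closed [simp]: "x \<in> carrier G \<Longrightarrow> y \<in> carrier G \<Longrightarrow> x \<odot> y \<in> carrier G"
  and qinv_closed [simp]: "x \<in> carrier G \<Longrightarrow> inv\<^bsub>Q\<^esub> x \<in> carrier G"
  using Q.m_closed Q.inv_closed by simp_all

section \<open>The maps \<lambda> and \<mu>: conjugation formulas and group actions\<close>

lemma lam_conj:
  assumes "x \<in> carrier G" "y \<in> carrier G"
  shows "lam x y = inv (fB x) \<otimes> y \<otimes> fB x"
proof -
  have "inv x = inv (fB x) \<otimes> inv (fA x)"
    using assms by (metis fA_fB inv_mult_group fA_closed fB_closed)
  \<comment> \<open>The factor \<open>inv (fA x)\<close> cancels the leading \<open>fA x\<close> of
    \<open>x \<odot> y\<close>.\<close>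
  then show ?thesis
    using assms by (simp add: brace_lambda_def qmult_eq m_assoc)
qed

lemma lam_closed [simp]: "x \<in> carrier G \<Longrightarrow> y \<in> carrier G \<Longrightarrow> lam x y \<in> carrier G"
  by (simp add: lam_conj)

lemma mu_closed [simp]: "x \<in> carrier G \<Longrightarrow> y \<in> carrier G \<Longrightarrow> mu y x \<in> carrier G"
  by (simp add: brace_mu_def)

lemma mult_lam: "x \<in> carrier G \<Longrightarrow> y \<in> carrier G \<Longrightarrow> x \<otimes> lam x y = x \<odot> y"
  by (simp add: brace_lambda_def m_assoc[symmetric])

lemma lam_qmult_mu:
  "x \<in> carrier G \<Longrightarrow> y \<in> carrier G \<Longrightarrow> lam x y \<odot> mu y x = x \<odot> y"
  by (simp add: brace_mu_def Q.m_assoc[symmetric])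

lemma mu_conj:
  assumes "x \<in> carrier G" "y \<in> carrier G"
  shows "mu y x = inv (fA (lam x y)) \<otimes> x \<otimes> fA (lam x y)"
proof -
  let ?u = "lam x y"
  \<comment> \<open>Both sides are \<open>x \<odot> y\<close>: the left one is
    \<open>?u \<odot> mu y x\<close>, the right one \<open>x \<otimes> ?u\<close>. The common
    \<open>fB ?u\<close> then cancels.\<close>
  have "fA ?u \<otimes> mu y x \<otimes> fB ?u = x \<otimes> (fA ?u \<otimes> fB ?u)"
    using lam_qmult_mu[OF assms] mult_lam[OF assms] assms by (simp add: qmult_eq[of ?u] fA_fB)
  then have "fA ?u \<otimes> mu y x = x \<otimes> fA ?u"
    using assms by (simp add: m_assoc[symmetric])
  then show ?thesis
    using assms by (metis inv_solve_left m_assoc fA_closed inv_closed lam_closed mu_closed m_closed)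
qed

text \<open>Conjugation from the right reverses products and so does \<open>fB\<close>; together
  they give a left action of \<open>Q\<close>.\<close>

lemma lam_act:
  "x \<in> carrier G \<Longrightarrow> y \<in> carrier G \<Longrightarrow> w \<in> carrier G \<Longrightarrow> lam (x \<odot> y) w = lam x (lam y w)"
  by (simp add: lam_conj fB_qmult inv_mult_group m_assoc)

lemma lam_mult:
  assumes "x \<in> carrier G" "y \<in> carrier G" "w \<in> carrier G"
  shows "lam x (y \<otimes> w) = lam x y \<otimes> lam x w"
  using assms by (simp add: lam_conj m_assoc)

text \<open>Since \<open>y \<odot> w = y \<otimes> lam y w\<close> and \<open>lam x\<close> is an
  endomorphism of \<open>G\<close>, the action of
  \<open>x \<odot> y = lam x y \<odot> mu y x\<close> can be split in the second way.\<close>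

lemma lam_qmult:
  assumes "x \<in> carrier G" "y \<in> carrier G" "w \<in> carrier G"
  shows "lam x (y \<odot> w) = lam x y \<odot> lam (mu y x) w"
proof -
  have "lam x (y \<odot> w) = lam x y \<otimes> lam (x \<odot> y) w"
    using assms by (simp add: mult_lam[symmetric, of y w] lam_mult lam_act)
  also have "\<dots> = lam x y \<otimes> lam (lam x y) (lam (mu y x) w)"
    using assms by (simp add: lam_qmult_mu[symmetric, of x y] lam_act)
  finally show ?thesis
    using assms by (simp add: mult_lam)
qed

text \<open>Both sides are the element that completes \<open>lam x (y \<odot> w)\<close> to the
  product \<open>x \<odot> (y \<odot> w)\<close>, so they agree by cancellation in
  \<open>Q\<close>.\<close>

lemma mu_act:
  assumes "x \<in> carrier G" "y \<in> carrier G" "w \<in> carrier G"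
  shows "mu (y \<odot> w) x = mu w (mu y x)"
proof -
  have "lam x (y \<odot> w) \<odot> mu w (mu y x) = x \<odot> (y \<odot> w)"
    \<comment> \<open>Product preservation is used first for the pair \<open>mu y x\<close>,
      \<open>w\<close> and, after regrouping, for \<open>x\<close>, \<open>y\<close>.\<close>
    using assms by (simp add: lam_qmult Q.m_assoc lam_qmult_mu)
      (simp add: lam_qmult_mu Q.m_assoc[symmetric])
  also have "\<dots> = lam x (y \<odot> w) \<odot> mu (y \<odot> w) x"
    using assms by (simp add: lam_qmult_mu)
  finally show ?thesis
    using assms by simp
qed

lemma mu_one: "x \<in> carrier G \<Longrightarrow> mu \<one> x = x"
  by (simp add: mu_conj lam_conj fA_one)

lemma lam_one: "x \<in> carrier G \<Longrightarrow> lam \<one> x = x"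
  by (simp add: lam_conj fB_one)

section \<open>The Yang--Baxter equation and non-degeneracy\<close>

abbreviation sol where "sol \<equiv> associated_solution G A B"

lemma sol_eq: "sol (x, y) = (lam x y, mu y x)"
  by (simp add: associated_solution_def)

lemma ybe_solution_sol: "ybe_solution (carrier G) sol"
  unfolding ybe_solution_def
proof (intro conjI ballI)
  show "sol \<in> carrier G \<times> carrier G \<rightarrow> carrier G \<times> carrier G"
    by (auto simp: sol_eq)
next
  fix t assume "t \<in> carrier G \<times> carrier G \<times> carrier G"
  then obtain x y w where t: "t = (x, y, w)"
    and C: "x \<in> carrier G" "y \<in> carrier G" "w \<in> carrier G" by auto
  define u v where "u = lam x y" and "v = mu y x"
  define p q where "p = lam y w" and "q = mu w y"
  have C': "u \<in> carrier G" "v \<in> carrier G" "p \<in> carrier G" "q \<in> carrier G"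
    using C by (simp_all add: u_def v_def p_def q_def)
  have uv: "u \<odot> v = x \<odot> y" and pq: "p \<odot> q = y \<odot> w"
    using C by (simp_all add: u_def v_def p_def q_def lam_qmult_mu)
  \<comment> \<open>The outer components agree by the two action laws.\<close>
  have 1: "lam u (lam v w) = lam x p"
    using C C' uv by (metis lam_act p_def)
  have 3: "mu w v = mu q (mu p x)"
    using C C' pq by (metis mu_act v_def)
  \<comment> \<open>Each application of \<open>sol\<close> preserves the product in
    \<open>Q\<close>, so both output triples have product \<open>x \<odot> y \<odot> w\<close>.
    Cancelling the equal outer factors leaves the middle components.\<close>
  have "lam u (lam v w) \<odot> mu (lam v w) u \<odot> mu w v = x \<odot> y \<odot> w"
    using C C' by (simp add: lam_qmult_mu Q.m_assoc) (simp add: Q.m_assoc[symmetric] uv)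
  also have "\<dots> = lam x p \<odot> lam (mu p x) q \<odot> mu q (mu p x)"
    using C C' by (simp add: lam_qmult_mu Q.m_assoc)
      (simp add: Q.m_assoc[symmetric] lam_qmult_mu, simp add: Q.m_assoc pq)
  finally have 2: "mu (lam v w) u = lam (mu p x) q"
    using C C' 1 3 by simp
  show "(prod_id sol \<circ> map_prod id sol \<circ> prod_id sol) t =
        (map_prod id sol \<circ> prod_id sol \<circ> map_prod id sol) t"
    using 1 2 3 by (simp add: t prod_id_def sol_eq u_def v_def p_def q_def)
qed

text \<open>By the action laws, \<open>lam x\<close> and \<open>mu y\<close> are inverted by the
  maps of the inverses of \<open>x\<close> and \<open>y\<close> in \<open>Q\<close>.\<close>

lemma nondegenerate_sol: "nondegenerate (carrier G) sol"
  unfolding nondegenerate_def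
proof (intro conjI ballI)
  fix x assume x: "x \<in> carrier G"
  have "bij_betw (lam x) (carrier G) (carrier G)"
    by (rule bij_betw_byWitness[where f' = "lam (inv\<^bsub>Q\<^esub> x)"])
      (use x in \<open>auto simp: lam_act[symmetric] lam_one\<close>)
  then show "bij_betw (\<lambda>y. fst (sol (x, y))) (carrier G) (carrier G)"
    by (simp add: sol_eq)
next
  fix y assume y: "y \<in> carrier G"
  have "bij_betw (mu y) (carrier G) (carrier G)"
    by (rule bij_betw_byWitness[where f' = "mu (inv\<^bsub>Q\<^esub> y)"])
      (use y in \<open>auto simp: mu_act[symmetric] mu_one\<close>)
  then show "bij_betw (\<lambda>x. snd (sol (x, y))) (carrier G) (carrier G)"
    by (simp add: sol_eq)
qed

section \<open>Central elements and the reflection\<close>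

lemma central_conj:
  assumes "central G e" "g \<in> carrier G" "x \<in> carrier G"
  shows "inv (g \<otimes> e) \<otimes> x \<otimes> (g \<otimes> e) = inv g \<otimes> x \<otimes> g"
    and "inv g \<otimes> (x \<otimes> e) \<otimes> g = inv g \<otimes> x \<otimes> g \<otimes> e"
proof -
  have e: "e \<in> carrier G" "\<And>y. y \<in> carrier G \<Longrightarrow> e \<otimes> y = y \<otimes> e"
    using assms by (auto simp: central_def)
  have "inv (g \<otimes> e) \<otimes> x \<otimes> (g \<otimes> e) = inv e \<otimes> (inv g \<otimes> x \<otimes> g \<otimes> e)"
    using assms e(1) by (simp add: inv_mult_group m_assoc)
  also have "\<dots> = inv e \<otimes> (e \<otimes> (inv g \<otimes> x \<otimes> g))"
    using assms e by simp
  also have "\<dots> = inv g \<otimes> x \<otimes> g"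
    using assms e(1) by (simp add: m_assoc[symmetric])
  finally show "inv (g \<otimes> e) \<otimes> x \<otimes> (g \<otimes> e) = inv g \<otimes> x \<otimes> g" .
  show "inv g \<otimes> (x \<otimes> e) \<otimes> g = inv g \<otimes> x \<otimes> g \<otimes> e"
    using assms e by (simp add: m_assoc)
qed

context
  fixes c d
  assumes c: "c \<in> A" "central G c" and d: "d \<in> B" "central G d"
begin

lemma cd_closed [simp]: "c \<in> carrier G" "d \<in> carrier G"
  using c d by (simp_all add: central_def)

lemma c_comm: "x \<in> carrier G \<Longrightarrow> c \<otimes> x = x \<otimes> c"
  and d_comm: "x \<in> carrier G \<Longrightarrow> d \<otimes> x = x \<otimes> d"
  using c d by (simp_all add: central_def)

lemma central_cd: "central G (c \<otimes> d)"
proof -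
  have "c \<otimes> d \<otimes> x = x \<otimes> (c \<otimes> d)" if "x \<in> carrier G" for x
  proof -
    have "c \<otimes> d \<otimes> x = c \<otimes> x \<otimes> d"
      using that by (simp add: m_assoc d_comm)
    then show ?thesis
      using that by (simp add: m_assoc c_comm)
  qed
  then show ?thesis
    by (simp add: central_def)
qed

text \<open>Moving \<open>c\<close> to the left past \<open>fB x\<close> collects an element of
  \<open>A\<close> followed by one of \<open>B\<close>, from which the parts of the product can be
  read off.\<close>

lemma mult_cd_factored:
  assumes "x \<in> carrier G"
  shows "x \<otimes> (c \<otimes> d) = (fA x \<otimes> c) \<otimes> (fB x \<otimes> d)"
proof -
  have "x \<otimes> (c \<otimes> d) = fA x \<otimes> (fB x \<otimes> c) \<otimes> d"
    using assms by (simp add: m_assoc[symmetric] fA_fB)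
  also have "\<dots> = fA x \<otimes> (c \<otimes> fB x) \<otimes> d"
    using assms by (simp add: c_comm)
  finally show ?thesis
    using assms by (simp add: m_assoc)
qed

lemma fA_mult_cd: "x \<in> carrier G \<Longrightarrow> fA (x \<otimes> (c \<otimes> d)) = fA x \<otimes> c"
  and fB_mult_cd: "x \<in> carrier G \<Longrightarrow> fB (x \<otimes> (c \<otimes> d)) = fB x \<otimes> d"
  using c d by (simp_all add: mult_cd_factored fA_mult fB_mult fA_in fB_in A_simps B_simps)

lemma lam_mult_cd_right:
  "x \<in> carrier G \<Longrightarrow> y \<in> carrier G \<Longrightarrow> lam x (y \<otimes> (c \<otimes> d)) = lam x y \<otimes> (c \<otimes> d)"
  by (simp add: lam_conj central_conj(2)[OF central_cd])

lemma lam_mult_cd_left: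
  "x \<in> carrier G \<Longrightarrow> y \<in> carrier G \<Longrightarrow> lam (x \<otimes> (c \<otimes> d)) y = lam x y"
  by (simp add: lam_conj fB_mult_cd central_conj(1)[OF d(2)])

text \<open>The factor passes to \<open>lam x y\<close>, whose \<open>A\<close>-part thereby changes
  only by the central \<open>c\<close>; conjugation of \<open>x\<close> does not see it.\<close>

lemma mu_mult_cd_left:
  "x \<in> carrier G \<Longrightarrow> y \<in> carrier G \<Longrightarrow> mu (y \<otimes> (c \<otimes> d)) x = mu y x"
  by (simp add: mu_conj lam_mult_cd_right fA_mult_cd central_conj(1)[OF c(2)])

lemma mu_mult_cd_right:
  "x \<in> carrier G \<Longrightarrow> y \<in> carrier G \<Longrightarrow> mu y (x \<otimes> (c \<otimes> d)) = mu y x \<otimes> (c \<otimes> d)"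
  by (simp add: mu_conj lam_mult_cd_left central_conj(2)[OF central_cd])

lemma ybe_reflection_mult_cd: "ybe_reflection (carrier G) sol (\<lambda>x. x \<otimes> (c \<otimes> d))"
  unfolding ybe_reflection_def
  \<comment> \<open>The four rules move every factor \<open>c \<otimes> d\<close> out of
    \<open>lam\<close> and \<open>mu\<close> or drop it, which brings both sides to the same
    form.\<close>
  by (auto simp: ybe_solution_sol nondegenerate_sol sol_eq lam_mult_cd_right lam_mult_cd_left
      mu_mult_cd_left mu_mult_cd_right)

end

end

theorem theorem4p2:
  fixes G :: "('a, 'm) monoid_scheme" and A B :: "'a set" and c d :: 'a
  assumes "group G"
    and "exact_factorization G A B"
    and "c \<in> A" and "d \<in> B"
    and "central G c" and "central G d"
    and "central G (c \<otimes>\<^bsub>G\<^esub> d)"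
  shows "ybe_reflection (carrier G) (associated_solution G A B)
           (\<lambda>x. x \<otimes>\<^bsub>G\<^esub> (c \<otimes>\<^bsub>G\<^esub> d))"
proof -
  interpret exactly_factorized_group G A B
    using assms(1,2) by (simp add: exactly_factorized_group_def exactly_factorized_group_axioms_def)
  show ?thesis
    using assms(3-6) by (intro ybe_reflection_mult_cd)
qed

end
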